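(* Each $f\in\mathrm{Diffeo}^+(\mathbb{R})$ can be expressed as a composite $f=f_1f_2f_3f_4$ of four elements $f_1,f_2,f_3,f_4$ of $\mathrm{Diffeo}^+(\mathbb{R})$, each of which is reversible in $\mathrm{Diffeo}^+(\mathbb{R})$.
   Context: A diffeomorphism of $\mathbb{R}$ is an infinitely differentiable homeomorphism of $\mathbb{R}$ onto itself whose derivative never vanishes. $\mathrm{Diffeo}^+(\mathbb{R})$ is the group, under composition, of all order preserving (strictly increasing) diffeomorphisms of $\mathbb{R}$. An element $f$ of a group $G$ is reversible in $G$ if there is $h\in G$ with $hfh^{-1}=f^{-1}$. *)

theory Defs
  imports "HOL-Analysis.Analysis" "HOL-Algebra.Group"
begin

definition infinitely_differentiable :: "(real \<Rightarrow> real) \<Rightarrow> bool" where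
  "infinitely_differentiable f \<longleftrightarrow> (\<forall>n x. (deriv ^^ n) f differentiable (at x))"

definition diffeomorphism_R :: "(real \<Rightarrow> real) \<Rightarrow> bool" where
  "diffeomorphism_R f \<longleftrightarrow>
     infinitely_differentiable f \<and> (\<exists>g. homeomorphism UNIV UNIV f g) \<and> (\<forall>x. deriv f x \<noteq> 0)"

definition Diffeo_plus :: "(real \<Rightarrow> real) monoid" where
  "Diffeo_plus = \<lparr>carrier = {f. diffeomorphism_R f \<and> strict_mono f}, mult = (\<circ>), one = id\<rparr>"

definition reversible_in :: "('a, 'b) monoid_scheme \<Rightarrow> 'a \<Rightarrow> bool" where
  "reversible_in G f \<longleftrightarrow>
     f \<in> carrier G \<and> (\<exists>h\<in>carrier G. h \<otimes>\<^bsub>G\<^esub> f \<otimes>\<^bsub>G\<^esub> inv\<^bsub>G\<^esub> h = inv\<^bsub>G\<^esub> f)"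

text \<open>
  The operation \<^const>\<open>m_inv\<close> is only meaningful in a group, so we verify that
  \<^const>\<open>Diffeo_plus\<close> is one and that its inverse is the inverse function.
\<close>

text \<open>A coinduction principle: membership in a class of differentiable functions closed under
  differentiation implies smoothness.\<close>

lemma infinitely_differentiable_coinduct:
  assumes "f \<in> S" and step: "\<And>h. h \<in> S \<Longrightarrow> \<exists>h'\<in>S. \<forall>x. (h has_field_derivative h' x) (at x)"
  shows "infinitely_differentiable f"
proof -
  have "(deriv ^^ n) f \<in> S" for n
  proof (induction n)
    case (Suc n)
    obtain h' where h': "h' \<in> S" "\<forall>x. ((deriv ^^ n) f has_field_derivative h' x) (at x)"
      using step[OF Suc] by blast
    then have "deriv ((deriv ^^ n) f) = h'"
      by (auto intro: DERIV_imp_deriv)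
    then show ?case using h' by simp
  qed (use assms in simp)
  then show ?thesis
    unfolding infinitely_differentiable_def
    using step real_differentiable_def by blast
qed

lemma infinitely_differentiable_DERIV:
  assumes "infinitely_differentiable f"
  shows "(f has_field_derivative deriv f x) (at x)"
proof -
  have "(deriv ^^ 0) f differentiable (at x)"
    using assms unfolding infinitely_differentiable_def by blast
  then show ?thesis
    by (simp add: DERIV_deriv_iff_real_differentiable)
qed

lemma infinitely_differentiable_deriv:
  assumes "infinitely_differentiable f"
  shows "infinitely_differentiable (deriv f)"
  unfolding infinitely_differentiable_def
proof (intro allI)
  fix n x
  have "(deriv ^^ Suc n) f differentiable (at x)"
    using assms unfolding infinitely_differentiable_def by blast
  then show "(deriv ^^ n) (deriv f) differentiable (at x)"
    by (simp only: funpow_Suc_right comp_apply)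
qed

inductive_set smooth_closure :: "(real \<Rightarrow> real) set" where
  base: "infinitely_differentiable f \<Longrightarrow> f \<in> smooth_closure"
| add: "f \<in> smooth_closure \<Longrightarrow> g \<in> smooth_closure \<Longrightarrow> (\<lambda>x. f x + g x) \<in> smooth_closure"
| mult: "f \<in> smooth_closure \<Longrightarrow> g \<in> smooth_closure \<Longrightarrow> (\<lambda>x. f x * g x) \<in> smooth_closure"
| comp: "f \<in> smooth_closure \<Longrightarrow> g \<in> smooth_closure \<Longrightarrow> (\<lambda>x. f (g x)) \<in> smooth_closure"
| inverse: "f \<in> smooth_closure \<Longrightarrow> (\<And>x. f x \<noteq> 0) \<Longrightarrow> (\<lambda>x. inverse (f x)) \<in> smooth_closure"
| inv_fun: "f \<in> smooth_closure \<Longrightarrow> (\<And>x. (f has_field_derivative f' x) (at x)) \<Longrightarrow>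
    f' \<in> smooth_closure \<Longrightarrow> (\<And>x. f' x \<noteq> 0) \<Longrightarrow> (\<And>x. f (g x) = x) \<Longrightarrow>
    continuous_on UNIV g \<Longrightarrow> g \<in> smooth_closure"

lemma infinitely_differentiable_const: "infinitely_differentiable (\<lambda>x. c)"
proof (rule infinitely_differentiable_coinduct)
  show "(\<lambda>x. c) \<in> range (\<lambda>c x. c)" by blast
  show "\<exists>h'\<in>range (\<lambda>c x. c). \<forall>x. (h has_field_derivative h' x) (at x)"
    if "h \<in> range (\<lambda>c x. c)" for h :: "real \<Rightarrow> real"
    using that by (intro bexI[of _ "\<lambda>x. 0"]) auto
qed

lemma infinitely_differentiable_id: "infinitely_differentiable (\<lambda>x. x)"
proof (rule infinitely_differentiable_coinduct)
  let ?S = "insert (\<lambda>x. x) (range (\<lambda>c x. c)) :: (real \<Rightarrow> real) set"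
  show "(\<lambda>x. x) \<in> ?S" by blast
  show "\<exists>h'\<in>?S. \<forall>x. (h has_field_derivative h' x) (at x)" if "h \<in> ?S" for h
  proof (cases "h = (\<lambda>x. x)")
    case True
    then show ?thesis by (intro bexI[of _ "\<lambda>x. 1"]) auto
  next
    case False
    then show ?thesis using that by (intro bexI[of _ "\<lambda>x. 0"]) auto
  qed
qed

lemma smooth_closure_DERIV:
  assumes "h \<in> smooth_closure"
  shows "\<exists>h'\<in>smooth_closure. \<forall>x. (h has_field_derivative h' x) (at x)"
  using assms
proof induction
  case (base f)
  then show ?case
    using infinitely_differentiable_DERIV infinitely_differentiable_deriv smooth_closure.base
    by blast
next
  case (add f g)
  then obtain f' g' where "f' \<in> smooth_closure" "\<forall>x. (f has_field_derivative f' x) (at x)"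
    "g' \<in> smooth_closure" "\<forall>x. (g has_field_derivative g' x) (at x)" by blast
  then show ?case
    by (intro bexI[of _ "\<lambda>x. f' x + g' x"]) (auto intro: smooth_closure.add DERIV_add)
next
  case (mult f g)
  then obtain f' g' where "f' \<in> smooth_closure" "\<forall>x. (f has_field_derivative f' x) (at x)"
    "g' \<in> smooth_closure" "\<forall>x. (g has_field_derivative g' x) (at x)" by blast
  then show ?case using mult
    by (intro bexI[of _ "\<lambda>x. f' x * g x + g' x * f x"])
       (auto intro!: smooth_closure.add smooth_closure.mult DERIV_mult)
next
  case (comp f g)
  then obtain f' g' where *: "f' \<in> smooth_closure" "\<forall>x. (f has_field_derivative f' x) (at x)"
    "g' \<in> smooth_closure" "\<forall>x. (g has_field_derivative g' x) (at x)" by blast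
  show ?case
  proof (intro bexI allI)
    show "(\<lambda>x. f' (g x) * g' x) \<in> smooth_closure"
      by (rule smooth_closure.mult[OF smooth_closure.comp[OF *(1) comp.hyps(2)] *(3)])
    show "((\<lambda>x. f (g x)) has_field_derivative f' (g x) * g' x) (at x)" for x
      by (rule DERIV_chain2[OF *(2)[rule_format] *(4)[rule_format]])
  qed
next
  case (inverse f)
  then obtain f' where f': "f' \<in> smooth_closure" "\<forall>x. (f has_field_derivative f' x) (at x)"
    by blast
  let ?r = "\<lambda>x. inverse (f x)"
  have r: "?r \<in> smooth_closure" using inverse by (auto intro: smooth_closure.inverse)
  have "(\<lambda>x. (- 1) * (?r x * f' x * ?r x)) \<in> smooth_closure"
    by (intro smooth_closure.mult r f' smooth_closure.base infinitely_differentiable_const)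
  moreover have "\<forall>x. (?r has_field_derivative (- 1) * (?r x * f' x * ?r x)) (at x)"
    using DERIV_inverse'[OF f'(2)[rule_format] inverse.hyps(2)] by simp
  ultimately show ?case 
    by (intro bexI[of _ "\<lambda>x. (- 1) * (?r x * f' x * ?r x)"]) blast+
next
  case (inv_fun f f' g)
  have g: "g \<in> smooth_closure"
    by (rule smooth_closure.inv_fun[OF inv_fun.hyps(1-6)])
  have "(\<lambda>x. inverse (f' (g x))) \<in> smooth_closure"
    by (rule smooth_closure.inverse[OF smooth_closure.comp[OF inv_fun.hyps(3) g]])
      (rule inv_fun.hyps(4))
  moreover have "(g has_field_derivative inverse (f' (g x))) (at x)" for x
  proof (rule DERIV_inverse_function)
    show "isCont g x" using inv_fun.hyps(6) by (simp add: continuous_on_eq_continuous_at)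
    show "x - 1 < x" "x < x + 1" by simp_all
  qed (rule inv_fun.hyps(2,4,5))+
  ultimately show ?case by (intro bexI[of _ "\<lambda>x. inverse (f' (g x))"]) auto
qed

lemma smooth_closure_iff: "f \<in> smooth_closure \<longleftrightarrow> infinitely_differentiable f"
  using infinitely_differentiable_coinduct[OF _ smooth_closure_DERIV] smooth_closure.base by blast

lemma Diffeo_plus_simps [simp]:
  "f \<in> carrier Diffeo_plus \<longleftrightarrow> diffeomorphism_R f \<and> strict_mono f"
  "f \<otimes>\<^bsub>Diffeo_plus\<^esub> g = f \<circ> g"
  "\<one>\<^bsub>Diffeo_plus\<^esub> = id"
  by (simp_all add: Diffeo_plus_def)

lemma Diffeo_plus_comp:
  assumes "f \<in> carrier Diffeo_plus" "g \<in> carrier Diffeo_plus"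
  shows "f \<circ> g \<in> carrier Diffeo_plus"
proof -
  have sm: "infinitely_differentiable f" "infinitely_differentiable g"
    and nz: "\<And>x. deriv f x \<noteq> 0" "\<And>x. deriv g x \<noteq> 0"
    using assms by (auto simp: diffeomorphism_R_def)
  have "(\<lambda>x. f (g x)) \<in> smooth_closure"
    by (rule smooth_closure.comp[OF sm[THEN smooth_closure.base]])
  moreover have "deriv (\<lambda>x. f (g x)) x = deriv f (g x) * deriv g x" for x
    by (intro DERIV_imp_deriv DERIV_chain2 infinitely_differentiable_DERIV sm)
  moreover have "\<exists>k. homeomorphism UNIV UNIV (f \<circ> g) k"
    using assms by (auto simp: diffeomorphism_R_def intro: homeomorphism_compose)
  ultimately show ?thesis
    using assms nz
    by (auto simp: diffeomorphism_R_def smooth_closure_iff o_def strict_mono_def)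
qed

lemma Diffeo_plus_inv:
  assumes "f \<in> carrier Diffeo_plus"
  shows "inv_into UNIV f \<in> carrier Diffeo_plus"
    and "inv_into UNIV f \<circ> f = id" and "f \<circ> inv_into UNIV f = id"
proof -
  have sm: "infinitely_differentiable f" and nz: "\<And>x. deriv f x \<noteq> 0" and mono: "strict_mono f"
    using assms by (auto simp: diffeomorphism_R_def)
  obtain g where g: "homeomorphism UNIV UNIV f g"
    using assms by (auto simp: diffeomorphism_R_def)
  then have gf: "g (f x) = x" and fg: "f (g x) = x" and cont: "continuous_on UNIV g" for x
    by (auto simp: homeomorphism_def)
  have inv: "inv_into UNIV f = g"
    using inv_equality[of g f] gf fg by blast
  have smg: "g \<in> smooth_closure"
    by (rule smooth_closure.inv_fun[of f "deriv f"])
       (use sm nz fg cont in \<open>auto intro: smooth_closure.base infinitely_differentiable_DERIV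
          infinitely_differentiable_deriv\<close>)
  have der: "deriv g x \<noteq> 0" for x
  proof
    assume 0: "deriv g x = 0"
    have "((\<lambda>x. f (g x)) has_field_derivative deriv f (g x) * deriv g x) (at x)"
      using sm smg by (intro DERIV_chain2 infinitely_differentiable_DERIV)
        (auto simp: smooth_closure_iff)
    with 0 have "((\<lambda>x::real. x) has_field_derivative 0) (at x)" by (simp add: fg)
    then show False using DERIV_unique[OF _ DERIV_ident] by fastforce
  qed
  have "strict_mono g"
    using strict_mono_inv[OF mono] gf fg by (metis surjI)
  then show "inv_into UNIV f \<in> carrier Diffeo_plus"
    using smg der g by (auto simp: inv diffeomorphism_R_def smooth_closure_iff
        intro: homeomorphism_symD)
  show "inv_into UNIV f \<circ> f = id" "f \<circ> inv_into UNIV f = id"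
    by (auto simp: inv gf fg)
qed

lemma group_Diffeo_plus: "group Diffeo_plus"
proof (rule groupI)
  show "\<one>\<^bsub>Diffeo_plus\<^esub> \<in> carrier Diffeo_plus"
    using infinitely_differentiable_id
    by (auto simp: diffeomorphism_R_def id_def strict_mono_def
        intro: homeomorphism_ident exI[of _ "\<lambda>x. x"])
  show "\<exists>y\<in>carrier Diffeo_plus. y \<otimes>\<^bsub>Diffeo_plus\<^esub> x = \<one>\<^bsub>Diffeo_plus\<^esub>"
    if "x \<in> carrier Diffeo_plus" for x
    using Diffeo_plus_inv(1,2)[OF that] by (intro bexI[of _ "inv_into UNIV x"]) auto
qed (use Diffeo_plus_comp in \<open>auto simp: o_assoc\<close>)

lemma m_inv_Diffeo_plus:
  assumes "f \<in> carrier Diffeo_plus"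
  shows "inv\<^bsub>Diffeo_plus\<^esub> f = inv_into UNIV f"
  using group.inv_equality[OF group_Diffeo_plus _ assms Diffeo_plus_inv(1)[OF assms]]
    Diffeo_plus_inv(2)[OF assms] by simp

end

theory Submission
  imports Defs
begin

text \<open>A fixed-point-free \<open>f > id\<close> has a smooth Abel function \<open>k\<close> with \<open>k \<circ> f = k + 1\<close>, so any two such
  diffeomorphisms are conjugate to the translation by 1 and hence to each other. One of them is a
  product of two reversibles: the lift to the line of a hyperbolic element of \<open>PSL\<^sub>2(\<real>)\<close> acting on
  the circle, chosen with fixed points, is reversed by a translation, and two such lifts can have a
  product which lifts an elliptic element. So every fixed-point-free diffeomorphism is a product of two
  reversibles. Finally \<open>f = (f \<circ> g\<^sup>-\<^sup>1) \<circ> g\<close> with both factors fixed-point-free, as soon as \<open>g\<close> lies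
  above both \<open>f\<close> and the identity.\<close>

section \<open>Smooth functions\<close>

lemma infinitely_differentiable_add:
  "infinitely_differentiable f \<Longrightarrow> infinitely_differentiable g \<Longrightarrow>
    infinitely_differentiable (\<lambda>x. f x + g x)"
  by (metis smooth_closure.add smooth_closure_iff)

lemma infinitely_differentiable_mult:
  "infinitely_differentiable f \<Longrightarrow> infinitely_differentiable g \<Longrightarrow>
    infinitely_differentiable (\<lambda>x. f x * g x)"
  by (metis smooth_closure.mult smooth_closure_iff)

lemma infinitely_differentiable_compose:
  "infinitely_differentiable f \<Longrightarrow> infinitely_differentiable g \<Longrightarrow>
    infinitely_differentiable (\<lambda>x. f (g x))"
  by (metis smooth_closure.comp smooth_closure_iff)

lemma infinitely_differentiable_diff:
  assumes "infinitely_differentiable f" "infinitely_differentiable g"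
  shows "infinitely_differentiable (\<lambda>x. f x - g x)"
  using infinitely_differentiable_add[OF assms(1)
      infinitely_differentiable_mult[OF infinitely_differentiable_const[of "-1"] assms(2)]]
  by simp

lemma infinitely_differentiable_divide:
  assumes "infinitely_differentiable f" "infinitely_differentiable g" "\<And>x. g x \<noteq> 0"
  shows "infinitely_differentiable (\<lambda>x. f x / g x)"
  using assms unfolding divide_inverse
  by (metis smooth_closure.inverse smooth_closure_iff infinitely_differentiable_mult)

lemma infinitely_differentiable_sum:
  assumes "\<And>i. i \<in> I \<Longrightarrow> infinitely_differentiable (f i)"
  shows "infinitely_differentiable (\<lambda>x. \<Sum>i\<in>I. f i x)"
  using assms
  by (induction I rule: infinite_finite_induct)
     (auto intro: infinitely_differentiable_const infinitely_differentiable_add)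

text \<open>Adjoining \<open>f\<close> to \<open>smooth_closure\<close> keeps the class closed under
  differentiation, so coinduction applies. Functions built from \<open>arctan\<close> and
  \<open>ln\<close> are handled below through their derivatives alone.\<close>

lemma infinitely_differentiable_antiderivative:
  assumes "\<And>x. (f has_field_derivative f' x) (at x)" "infinitely_differentiable f'"
  shows "infinitely_differentiable f"
  by (rule infinitely_differentiable_coinduct[of f "insert f smooth_closure"])
     (use assms smooth_closure.base smooth_closure_DERIV in blast)+

lemma infinitely_differentiable_exp: "infinitely_differentiable (exp :: real \<Rightarrow> real)"
  by (rule infinitely_differentiable_coinduct[of _ "{exp}"]) (auto intro: DERIV_exp)

lemma infinitely_differentiable_sin: "infinitely_differentiable (sin :: real \<Rightarrow> real)"
proof (rule infinitely_differentiable_coinduct)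
  let ?S = "{sin, cos, \<lambda>x. - sin x, \<lambda>x. - cos x} :: (real \<Rightarrow> real) set"
  show "sin \<in> ?S" by simp
  show "\<exists>h'\<in>?S. \<forall>x. (h has_field_derivative h' x) (at x)" if "h \<in> ?S" for h
    using that by (elim insertE emptyE; simp) (auto intro!: derivative_eq_intros)
qed

lemmas infinitely_differentiable_intros =
  infinitely_differentiable_const infinitely_differentiable_id
  infinitely_differentiable_add infinitely_differentiable_diff infinitely_differentiable_mult
  infinitely_differentiable_divide infinitely_differentiable_sum

text \<open>Agreement near \<open>x\<close> is also agreement near every point close to
  \<open>x\<close>, so it passes from each derivative to the next. This is what lets a locally
  finite sum be treated as a finite one.\<close>

lemma infinitely_differentiable_local:
  assumes "\<And>x. \<exists>g. infinitely_differentiable g \<and> eventually (\<lambda>y. f y = g y) (nhds x)"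
  shows "infinitely_differentiable f"
  unfolding infinitely_differentiable_def
proof (intro allI)
  fix n x
  obtain g where g: "infinitely_differentiable g" "eventually (\<lambda>y. f y = g y) (nhds x)"
    using assms by blast
  have "eventually (\<lambda>y. (deriv ^^ n) f y = (deriv ^^ n) g y) (nhds x)"
  proof (induction n)
    case (Suc n)
    then have "eventually (\<lambda>z. eventually (\<lambda>y. (deriv ^^ n) f y = (deriv ^^ n) g y) (nhds z)) (nhds x)"
      by (simp add: eventually_eventually)
    then show ?case
      by eventually_elim (auto intro: deriv_cong_ev)
  qed (use g in simp)
  moreover have "(deriv ^^ n) g differentiable at x"
    using g(1) by (simp add: infinitely_differentiable_def)
  ultimately show "(deriv ^^ n) f differentiable at x"
    using DERIV_cong_ev[OF refl _ refl] by (metis real_differentiable_def)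
qed

section \<open>Recognising elements of \<open>Diffeo_plus\<close>\<close>

text \<open>A positive derivative makes \<open>f\<close> strictly increasing, hence injective. An
  injective continuous map of the line is open, so the inverse is continuous.\<close>

lemma Diffeo_plusI:
  assumes "infinitely_differentiable f" "\<And>x. deriv f x > 0" "surj f"
  shows "f \<in> carrier Diffeo_plus"
proof -
  have mono: "strict_mono f"
    using DERIV_pos_imp_increasing infinitely_differentiable_DERIV[OF assms(1)] assms(2)
    by (metis strict_monoI)
  have cont: "continuous_on UNIV f"
    using infinitely_differentiable_DERIV[OF assms(1)] DERIV_isCont
    by (metis continuous_at_imp_continuous_on)
  have "inj f" using mono by (simp add: strict_mono_imp_inj_on)
  have "openin (top_of_set UNIV) (f ` T)" if "openin (top_of_set UNIV) T" for T
    using injective_into_1d_imp_open_map_UNIV[of T UNIV f] cont \<open>inj f\<close> that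
    by simp
  then have "\<exists>g. homeomorphism UNIV UNIV f g"
    using homeomorphism_injective_open_map[OF cont assms(3) \<open>inj f\<close>] by metis
  then show ?thesis
    using assms mono by (auto simp: diffeomorphism_R_def) (metis less_irrefl)
qed

lemma Diffeo_plusD:
  assumes "f \<in> carrier Diffeo_plus"
  shows "infinitely_differentiable f" "continuous_on A f" "strict_mono f" "bij f" "deriv f x > 0"
proof -
  show s: "infinitely_differentiable f" "strict_mono f"
    using assms by (auto simp: diffeomorphism_R_def)
  show "continuous_on A f"
    using infinitely_differentiable_DERIV[OF s(1)] DERIV_isCont
    by (metis continuous_at_imp_continuous_on)
  show "bij f" using Diffeo_plus_inv(2,3)[OF assms] by (metis o_bij)
  have "deriv f x \<ge> 0"
    using mono_on_imp_deriv_nonneg[of UNIV f "deriv f x" x] s infinitely_differentiable_DERIV[OF s(1)]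
    by (metis UNIV_I interior_UNIV strict_mono_mono)
  moreover have "deriv f x \<noteq> 0" using assms by (auto simp: diffeomorphism_R_def)
  ultimately show "deriv f x > 0" by simp
qed

lemma surj_real:
  fixes f :: "real \<Rightarrow> real"
  assumes "continuous_on UNIV f" "\<And>y. \<exists>x. f x \<le> y" "\<And>y. \<exists>x. f x \<ge> y"
  shows "surj f"
proof -
  have "y \<in> range f" for y
  proof -
    obtain a b where "f a \<le> y" "y \<le> f b" using assms(2,3) by meson
    moreover have "connected (range f)" 
      using assms(1) connected_continuous_image connected_UNIV by blast
    ultimately show ?thesis by (meson connectedD_interval rangeI)
  qed
  then show ?thesis by blast
qed

section \<open>Flat functions and a smooth step\<close>

text \<open>\<open>flat 1\<close> is the classical smooth function that vanishes to infinite order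
  at 0. The polynomial factor in \<open>1 / x\<close> makes the family closed under differentiation,
  as coinduction requires.\<close>

definition flat :: "real poly \<Rightarrow> real \<Rightarrow> real" where
  "flat p x = (if x > 0 then poly p (1 / x) * exp (- (1 / x)) else 0)"

lemma poly_exp_tendsto_0: "((\<lambda>s::real. poly p s * exp (- s)) \<longlongrightarrow> 0) at_top"
proof -
  have "((\<lambda>s::real. \<Sum>i\<le>degree p. coeff p i * (s ^ i / exp s))
      \<longlongrightarrow> (\<Sum>i\<le>degree p. coeff p i * 0)) at_top"
    by (intro tendsto_sum tendsto_mult tendsto_const tendsto_power_div_exp_0)
  then show ?thesis
    by (simp add: poly_altdef sum_distrib_right exp_minus divide_inverse mult.assoc)
qed

text \<open>For \<open>s = 1 / x\<close> one has \<open>ds/dx = - s^2\<close>, so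
  \<open>p(s) exp(-s)\<close> has derivative \<open>s^2 (p(s) - p'(s)) exp(-s)\<close>; the factor
  \<open>[:0, 0, 1:]\<close> is \<open>s^2\<close>.\<close>

lemma flat_DERIV: "(flat p has_field_derivative flat ([:0, 0, 1:] * (p - pderiv p)) x) (at x)"
proof (cases x "0::real" rule: linorder_cases)
  case less
  have "((\<lambda>x. 0) has_field_derivative 0) (at x)" by simp
  moreover have "eventually (\<lambda>y. flat p y = 0) (nhds x)"
    using less by (auto simp: flat_def eventually_nhds intro!: exI[of _ "{..<0}"])
  ultimately show ?thesis using less by (auto simp: flat_def DERIV_cong_ev[OF refl _ refl])
next
  case greater
  have "((\<lambda>x. poly p (1 / x) * exp (- (1 / x))) has_field_derivative
      poly ([:0, 0, 1:] * (p - pderiv p)) (1 / x) * exp (- (1 / x))) (at x)"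
    using greater by (auto intro!: derivative_eq_intros DERIV_chain2[OF poly_DERIV]
        simp: field_simps power2_eq_square)
  moreover have "eventually (\<lambda>y. flat p y = poly p (1 / y) * exp (- (1 / y))) (nhds x)"
    using greater by (auto simp: flat_def eventually_nhds intro!: exI[of _ "{0<..}"])
  ultimately show ?thesis using greater by (auto simp: flat_def DERIV_cong_ev[OF refl _ refl])
next
  case equal
  \<comment> \<open>The difference quotient at 0 divides by \<open>y\<close>, that is, multiplies by
    \<open>s = 1 / y\<close>; \<open>pCons 0 p\<close> absorbs this factor into the
    polynomial.\<close>
  have "((\<lambda>y. poly (pCons 0 p) (inverse y) * exp (- (inverse y))) \<longlongrightarrow> 0) (at_right 0)"
    by (rule filterlim_compose[OF poly_exp_tendsto_0 filterlim_inverse_at_top_right])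
  then have "((\<lambda>y. flat p y / y) \<longlongrightarrow> 0) (at_right 0)"
    by (rule tendsto_cong[THEN iffD1, rotated])
       (auto simp: flat_def eventually_at_right_field field_simps intro!: exI[of _ 1])
  moreover have "((\<lambda>y. flat p y / y) \<longlongrightarrow> 0) (at_left 0)"
    by (rule tendsto_eventually) (auto simp: flat_def eventually_at_left_field intro!: exI[of _ "-1"])
  ultimately have "((\<lambda>y. flat p y / y) \<longlongrightarrow> 0) (at 0)"
    using filterlim_split_at_real by blast
  then show ?thesis using equal by (simp add: has_field_derivative_iff flat_def)
qed

lemma infinitely_differentiable_flat: "infinitely_differentiable (flat p)"
  by (rule infinitely_differentiable_coinduct[of _ "range flat"]) (auto intro: flat_DERIV)

text \<open>The quotient \<open>u / (u + v)\<close> works because \<open>u\<close> vanishes exactly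
  up to \<open>a\<close> and \<open>v\<close> exactly from \<open>b\<close> on. As
  \<open>a < b\<close>, they never vanish together.\<close>

lemma smooth_step:
  fixes a b :: real
  assumes "a < b"
  obtains \<Phi> where "infinitely_differentiable \<Phi>" "\<And>x. x \<le> a \<Longrightarrow> \<Phi> x = 0" "\<And>x. x \<ge> b \<Longrightarrow> \<Phi> x = 1"
    "\<And>x. deriv \<Phi> x \<ge> 0" "\<And>x. a < x \<Longrightarrow> x < b \<Longrightarrow> deriv \<Phi> x > 0"
proof -
  define u where "u = (\<lambda>x. flat 1 (x - a))"
  define v where "v = (\<lambda>x. flat 1 (b - x))"
  define u' where "u' = (\<lambda>x. flat [:0, 0, 1:] (x - a))"
  define v' where "v' = (\<lambda>x. flat [:0, 0, 1:] (b - x))"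
  have u: "(u has_field_derivative u' x) (at x)" for x
    unfolding u_def u'_def
    by (auto intro!: DERIV_chain2[OF flat_DERIV, THEN DERIV_cong] derivative_eq_intros)
  have v: "(v has_field_derivative - v' x) (at x)" for x
    unfolding v_def v'_def
    by (auto intro!: DERIV_chain2[OF flat_DERIV, THEN DERIV_cong] derivative_eq_intros)
  have nn: "u x \<ge> 0" "v x \<ge> 0" "u' x \<ge> 0" "v' x \<ge> 0" for x
    by (auto simp: u_def v_def u'_def v'_def flat_def)
  have pos: "u x + v x > 0" for x
    using assms by (auto simp: u_def v_def flat_def add_pos_nonneg)
  define \<Phi> where "\<Phi> = (\<lambda>x. u x / (u x + v x))"
  have D: "deriv \<Phi> x = (u' x * v x + u x * v' x) / (u x + v x)\<^sup>2" for x
    unfolding \<Phi>_def using pos[of x]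
    by (auto intro!: DERIV_imp_deriv derivative_eq_intros u v simp: power2_eq_square algebra_simps)
  show ?thesis
  proof
    show "infinitely_differentiable \<Phi>"
      unfolding \<Phi>_def
    proof (intro infinitely_differentiable_intros)
      show "infinitely_differentiable u" "infinitely_differentiable u" "infinitely_differentiable v"
        unfolding u_def v_def
        by (intro infinitely_differentiable_compose[OF infinitely_differentiable_flat]
            infinitely_differentiable_intros)+
      show "u x + v x \<noteq> 0" for x using pos[of x] by simp
    qed
    show "\<Phi> x = 0" if "x \<le> a" for x using that by (simp add: \<Phi>_def u_def flat_def)
    show "\<Phi> x = 1" if "x \<ge> b" for x
      using that pos[of x] by (simp add: \<Phi>_def v_def flat_def)
    show "deriv \<Phi> x \<ge> 0" for x unfolding D using nn[of x] by simp
    show "deriv \<Phi> x > 0" if "a < x" "x < b" for x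
    proof -
      have "u x > 0" "v x > 0" "u' x > 0" "v' x > 0"
        using that by (auto simp: u_def v_def u'_def v'_def flat_def)
      then show ?thesis unfolding D by (simp add: add_pos_pos)
    qed
  qed
qed

section \<open>Abel functions\<close>

lemma deriv_compose:
  assumes "infinitely_differentiable f" "infinitely_differentiable g"
  shows "deriv (\<lambda>x. f (g x)) x = deriv f (g x) * deriv g x"
  using assms by (intro DERIV_imp_deriv DERIV_chain2 infinitely_differentiable_DERIV)

text \<open>Near each point the series is a finite sum. Since all terms have nonnegative derivative,
  a single term with positive derivative makes the derivative of the sum positive.\<close>

lemma locally_finite_suminf:
  fixes u :: "nat \<Rightarrow> real \<Rightarrow> real"
  assumes smooth: "\<And>n. infinitely_differentiable (u n)"
    and nonneg: "\<And>n x. deriv (u n) x \<ge> 0"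
    and locfin: "\<And>x. \<exists>N. \<forall>\<^sub>F y in nhds x. \<forall>n\<ge>N. u n y = 0"
  shows "infinitely_differentiable (\<lambda>x. \<Sum>n. u n x)" (is ?smooth)
    and "summable (\<lambda>n. u n x)" (is ?summable)
    and "deriv (u m) x \<le> deriv (\<lambda>x. \<Sum>n. u n x) x" (is ?deriv)
proof -
  \<comment> \<open>The demand \<open>N \<ge> m\<close> ensures that a prescribed term can be
    included in the finite sum.\<close>
  have finite_sum: "\<exists>N\<ge>m. \<forall>\<^sub>F y in nhds x. (\<Sum>n. u n y) = (\<Sum>n<N. u n y)" for x m
  proof -
    obtain N where N: "\<forall>\<^sub>F y in nhds x. \<forall>n\<ge>N. u n y = 0" using locfin by blast
    then have "\<forall>\<^sub>F y in nhds x. (\<Sum>n. u n y) = (\<Sum>n<max m N. u n y)"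
      by eventually_elim (intro suminf_finite, auto)
    then show ?thesis by (metis max.cobounded1)
  qed
  have partial: "infinitely_differentiable (\<lambda>y. \<Sum>n<N. u n y)" for N
    by (intro infinitely_differentiable_sum smooth)
  show ?smooth
    using finite_sum partial by (intro infinitely_differentiable_local) blast
  show ?summable
    using locfin[of x] eventually_nhds_x_imp_x
    by (metis (mono_tags, lifting) summable_finite finite_lessThan lessThan_iff linorder_not_le)
  show ?deriv
  proof -
    obtain N where N: "N \<ge> Suc m" "\<forall>\<^sub>F y in nhds x. (\<Sum>n. u n y) = (\<Sum>n<N. u n y)"
      using finite_sum by blast
    have "deriv (\<lambda>x. \<Sum>n. u n x) x = deriv (\<lambda>x. \<Sum>n<N. u n x) x"
      using N(2) by (intro deriv_cong_ev) auto
    also have "\<dots> = (\<Sum>n<N. deriv (u n) x)"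
      by (intro DERIV_imp_deriv DERIV_sum infinitely_differentiable_DERIV smooth)
    finally show ?thesis
      using N(1) nonneg member_le_sum[of m "{..<N}" "\<lambda>n. deriv (u n) x"] by simp
  qed
qed

text \<open>A bounded orbit would increase to a limit, and by continuity that limit would be a fixed
  point.\<close>

lemma funpow_at_top:
  fixes f :: "real \<Rightarrow> real"
  assumes "continuous_on UNIV f" "\<And>x. f x > x"
  shows "\<exists>n. (f ^^ n) x \<ge> M"
proof (rule ccontr)
  assume *: "\<nexists>n. (f ^^ n) x \<ge> M"
  have "incseq (\<lambda>n. (f ^^ n) x)"
    using assms(2) by (intro incseq_SucI) (simp add: less_imp_le)
  moreover have "\<forall>n. (f ^^ n) x \<le> M" using * by (meson linear)
  ultimately obtain L where L: "(\<lambda>n. (f ^^ n) x) \<longlonglongrightarrow> L"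
    using incseq_convergent by metis
  have "(\<lambda>n. f ((f ^^ n) x)) \<longlonglongrightarrow> f L"
    using L assms(1) by (metis UNIV_I continuous_on_tendsto_compose eventually_sequentially)
  moreover have "(\<lambda>n. f ((f ^^ n) x)) \<longlonglongrightarrow> L"
    using LIMSEQ_Suc[OF L] by simp
  ultimately show False using assms(2)[of L] LIMSEQ_unique by fastforce
qed

lemma funpow_carrier: "f \<in> carrier Diffeo_plus \<Longrightarrow> f ^^ n \<in> carrier Diffeo_plus"
proof (induction n)
  case 0
  show ?case using monoid.one_closed[OF group.is_monoid[OF group_Diffeo_plus]] by (simp add: id_def)
next
  case (Suc n)
  then show ?case using Diffeo_plus_comp[of f "f ^^ n"] by (metis funpow.simps(2))
qed

text \<open>The Abel function is the locally finite sum of the steps \<open>\<Phi> \<circ> f\<^sup>n\<close> over all integers \<open>n\<close>,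
  where the steps with \<open>n > 0\<close> are lowered by 1 to make the sum converge.\<close>

lemma abel_function:
  assumes f: "f \<in> carrier Diffeo_plus" and gt: "\<And>x. f x > x"
  obtains k where "k \<in> carrier Diffeo_plus" "\<And>x. k (f x) = k x + 1"
proof -
  define g where "g = inv_into UNIV f"
  have g: "g \<in> carrier Diffeo_plus" and gf [simp]: "\<And>x. g (f x) = x" and fg [simp]: "\<And>x. f (g x) = x"
    using Diffeo_plus_inv[OF f] by (auto simp: g_def fun_eq_iff simp del: Diffeo_plus_simps)
  have gfn [simp]: "(g ^^ n) ((f ^^ n) x) = x" for n x
    by (induction n arbitrary: x) (simp_all add: funpow_swap1)
  have lt: "g x < x" for x using gt[of "g x"] by simp
  have top: "\<exists>n. (f ^^ n) x \<ge> M" for x M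
    using funpow_at_top[OF Diffeo_plusD(2)[OF f] gt] .
  have mono_g: "strict_mono (g ^^ n)" and mono_f: "strict_mono (f ^^ n)" for n
    using f g funpow_carrier Diffeo_plusD(3) by blast+
  have bot: "\<exists>n. (g ^^ n) x \<le> M" for x M
    using top[of x M] mono_g gfn by (metis strict_mono_less_eq)
  have inc: "incseq (\<lambda>n. (f ^^ n) x)" for x
    using gt by (intro incseq_SucI) (simp add: less_imp_le)
  have dec: "decseq (\<lambda>n. (g ^^ n) x)" for x
    using lt by (intro decseq_SucI) (simp add: less_imp_le)
  \<comment> \<open>Every orbit meets the fundamental domain \<open>[0, f 0)\<close>. Starting the
    step at -1 instead of 0 puts the endpoint 0 inside the interval of positive derivative.\<close>
  have "-1 < f 0" using gt[of 0] by simp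
  then obtain \<Phi> where \<Phi>: "infinitely_differentiable \<Phi>"
    "\<And>x. x \<le> -1 \<Longrightarrow> \<Phi> x = 0" "\<And>x. x \<ge> f 0 \<Longrightarrow> \<Phi> x = 1"
    "\<And>x. deriv \<Phi> x \<ge> 0" "\<And>x. -1 < x \<Longrightarrow> x < f 0 \<Longrightarrow> deriv \<Phi> x > 0"
    using smooth_step by blast
  define \<Psi> where "\<Psi> = (\<lambda>x. \<Phi> x - 1)"
  have \<Psi>: "infinitely_differentiable \<Psi>" "deriv \<Psi> x = deriv \<Phi> x" for x
    unfolding \<Psi>_def using \<Phi>(1) infinitely_differentiable_DERIV[OF \<Phi>(1)]
    by (auto intro!: infinitely_differentiable_intros DERIV_imp_deriv derivative_eq_intros)
  \<comment> \<open>With \<open>g\<close> the inverse of \<open>f\<close>, \<open>u\<close> collects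
    the exponents \<open>n \<le> 0\<close> and \<open>v\<close> the exponents \<open>n > 0\<close>;
    \<open>Suc n\<close> in \<open>v\<close> avoids counting exponent 0 twice.\<close>
  define u where "u = (\<lambda>n x. \<Phi> ((g ^^ n) x))"
  define v where "v = (\<lambda>n x. \<Psi> ((f ^^ Suc n) x))"
  have gn: "infinitely_differentiable (g ^^ n)" "deriv (g ^^ n) x > 0"
    and fn: "infinitely_differentiable (f ^^ n)" "deriv (f ^^ n) x > 0" for n x
    using f g funpow_carrier Diffeo_plusD(1,5) by blast+
  have du: "deriv (u n) x = deriv \<Phi> ((g ^^ n) x) * deriv (g ^^ n) x" for n x
    unfolding u_def by (rule deriv_compose[OF \<Phi>(1) gn(1)])
  have dv: "deriv (v n) x = deriv \<Phi> ((f ^^ Suc n) x) * deriv (f ^^ Suc n) x" for n x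
    unfolding v_def \<Psi>(2)[symmetric] by (rule deriv_compose[OF \<Psi>(1) fn(1)])
  have u: "infinitely_differentiable (u n)" "deriv (u n) x \<ge> 0" for n x
    using infinitely_differentiable_compose[OF \<Phi>(1) gn(1)] gn(2) \<Phi>(4) 
    by (simp_all add: du less_imp_le) (simp add: u_def)
  have v: "infinitely_differentiable (v n)" "deriv (v n) x \<ge> 0" for n x
    using infinitely_differentiable_compose[OF \<Psi>(1) fn(1)] fn(2)[of "Suc n"] \<Phi>(4) 
    by (simp_all add: dv less_imp_le del: funpow.simps) (simp add: v_def del: funpow.simps)
  \<comment> \<open>One estimate at \<open>x + 1\<close> covers all \<open>y < x + 1\<close>:
    \<open>(g ^^ n) y\<close> is increasing in \<open>y\<close> and decreasing in
    \<open>n\<close>.\<close>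
  have u0: "\<exists>N. \<forall>\<^sub>F y in nhds x. \<forall>n\<ge>N. u n y = 0" for x
  proof -
    obtain N where N: "(g ^^ N) (x + 1) \<le> -1" using bot by blast
    have "u n y = 0" if "n \<ge> N" "y < x + 1" for n y
    proof -
      have "(g ^^ n) y \<le> (g ^^ n) (x + 1)" using that(2) mono_g by (simp add: strict_mono_less_eq)
      also have "\<dots> \<le> (g ^^ N) (x + 1)" using dec that(1) by (simp add: decseq_def)
      finally show ?thesis using N \<Phi>(2) by (simp add: u_def)
    qed
    then show ?thesis
      by (intro exI[of _ N]) (auto simp: eventually_nhds intro!: exI[of _ "{..<x+1}"])
  qed
  have v0: "\<exists>N. \<forall>\<^sub>F y in nhds x. \<forall>n\<ge>N. v n y = 0" for x
  proof -
    obtain N where N: "(f ^^ N) (x - 1) \<ge> f 0" using top by blast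
    have "v n y = 0" if "n \<ge> N" "y > x - 1" for n y
    proof -
      note N
      also have "(f ^^ N) (x - 1) \<le> (f ^^ Suc n) (x - 1)"
        using inc[of "x - 1"] that(1) incseqD le_SucI by blast
      also have "\<dots> \<le> (f ^^ Suc n) y"
        using that(2) mono_f by (simp add: strict_mono_less_eq del: funpow.simps)
      finally show ?thesis using \<Phi>(3) by (simp add: v_def \<Psi>_def)
    qed
    then show ?thesis
      by (intro exI[of _ N]) (auto simp: eventually_nhds intro!: exI[of _ "{x-1<..}"])
  qed
  note U = locally_finite_suminf[of u, OF u u0] and V = locally_finite_suminf[of v, OF v v0]
  define k where "k = (\<lambda>x. (\<Sum>n. u n x) + (\<Sum>n. v n x))"
  have smooth_k: "infinitely_differentiable k"
    unfolding k_def by (intro infinitely_differentiable_add U V)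
  have dk: "deriv k x = deriv (\<lambda>x. \<Sum>n. u n x) x + deriv (\<lambda>x. \<Sum>n. v n x) x" for x
    unfolding k_def by (intro DERIV_imp_deriv DERIV_add infinitely_differentiable_DERIV U V)
  \<comment> \<open>Replacing \<open>x\<close> by \<open>f x\<close> shifts the index: the first sum
    gains \<open>\<Phi> (f x)\<close> and the second loses \<open>\<Phi> (f x) - 1\<close>, a net
    change of 1.\<close>
  have kf: "k (f x) = k x + 1" for x
  proof -
    have "(\<Sum>n. u n (f x)) = (\<Sum>n. u (Suc n) (f x)) + u 0 (f x)"
      using suminf_split_head[OF U(2)] by simp
    also have "(\<lambda>n. u (Suc n) (f x)) = (\<lambda>n. u n x)"
      by (simp add: u_def funpow_Suc_right del: funpow.simps)
    finally have A: "(\<Sum>n. u n (f x)) = (\<Sum>n. u n x) + \<Phi> (f x)" by (simp add: u_def)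
    have "(\<Sum>n. v n x) = (\<Sum>n. v (Suc n) x) + v 0 x"
      using suminf_split_head[OF V(2)] by simp
    also have "(\<lambda>n. v (Suc n) x) = (\<lambda>n. v n (f x))"
      unfolding v_def by (simp only: funpow_Suc_right comp_apply)
    finally show ?thesis using A by (simp add: k_def v_def \<Psi>_def)
  qed
  have kg: "k (g x) = k x - 1" for x using kf[of "g x"] by simp
  have kfn: "k ((f ^^ n) x) = k x + n" and kgn: "k ((g ^^ n) x) = k x - n" for n x
    by (induction n) (simp_all add: kf kg)
  have "surj k"
  proof (rule surj_real)
    show "continuous_on UNIV k"
      using infinitely_differentiable_DERIV[OF smooth_k] DERIV_isCont
      by (metis continuous_at_imp_continuous_on)
    show "\<exists>x. k x \<le> y" for y
      using kgn real_arch_simple[of "k 0 - y"] by (metis diff_le_eq diff_diff_eq2 add.commute diff_le_eq)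
    show "\<exists>x. y \<le> k x" for y
      using kfn real_arch_simple[of "y - k 0"] by (metis diff_le_eq add.commute)
  qed
  moreover have "deriv k x > 0" for x
  proof (cases "x \<ge> 0")
    case True
    \<comment> \<open>The first backward iterate below \<open>f 0\<close> is still at least 0:
      either it is \<open>x\<close> itself, or its predecessor was at least \<open>f 0\<close>. So
      the term \<open>u n\<close> is strictly increasing at \<open>x\<close>.\<close>
    define n where "n = (LEAST n. (g ^^ n) x < f 0)"
    obtain m where "(g ^^ m) x \<le> 0" using bot by blast
    then have "(g ^^ m) x < f 0" using gt[of 0] by simp
    then have 1: "(g ^^ n) x < f 0" unfolding n_def by (rule LeastI)
    have "-1 < (g ^^ n) x"
    proof (cases n)
      case (Suc j)
      then have "(g ^^ j) x \<ge> f 0"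
        using not_less_Least[of j "\<lambda>n. (g ^^ n) x < f 0", folded n_def] by simp
      then have "g ((g ^^ j) x) \<ge> g (f 0)"
        using Diffeo_plusD(3)[OF g] strict_mono_less_eq by blast
      then show ?thesis using Suc by simp
    qed (use True in simp)
    with 1 have "deriv (u n) x > 0" using \<Phi>(5) gn(2) by (simp add: du)
    moreover have "deriv (v 0) x \<ge> 0" by (rule v)
    ultimately show ?thesis unfolding dk using U(3)[of n x] V(3)[of 0 x] by linarith
  next
    case False
    \<comment> \<open>Symmetrically, the first of the iterates \<open>f ^^ Suc n\<close> to reach 0
      comes from a negative point, so it stays below \<open>f 0\<close>.\<close>
    define n where "n = (LEAST n. (f ^^ Suc n) x \<ge> 0)"
    obtain m where "(f ^^ m) x \<ge> 0" using top by blast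
    then have "(f ^^ Suc m) x \<ge> 0" using gt[of "(f ^^ m) x"] by simp
    then have 1: "(f ^^ Suc n) x \<ge> 0" unfolding n_def by (rule LeastI)
    have "(f ^^ n) x < 0"
    proof (cases n)
      case (Suc j)
      then show ?thesis
        using not_less_Least[of j "\<lambda>n. (f ^^ Suc n) x \<ge> 0", folded n_def] by simp
    qed (use False in simp)
    then have "(f ^^ Suc n) x < f 0" using mono_f[of 1] by (simp add: strict_mono_less)
    with 1 have "deriv (v n) x > 0" using \<Phi>(5) fn(2)[of "Suc n"] by (simp add: dv del: funpow.simps)
    moreover have "deriv (u 0) x \<ge> 0" by (rule u)
    ultimately show ?thesis unfolding dk using U(3)[of 0 x] V(3)[of n x] by linarith
  qed
  ultimately have "k \<in> carrier Diffeo_plus" using smooth_k by (intro Diffeo_plusI)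
  then show ?thesis using kf that by blast
qed

section \<open>Products of two reversible elements\<close>

text \<open>The same \<open>h\<close> works: invert both sides of the reversing equation.\<close>

lemma reversible_in_inv:
  assumes "group G" "reversible_in G f"
  shows "reversible_in G (inv\<^bsub>G\<^esub> f)"
proof -
  interpret group G by fact
  obtain h where h: "f \<in> carrier G" "h \<in> carrier G" "h \<otimes>\<^bsub>G\<^esub> f \<otimes>\<^bsub>G\<^esub> inv\<^bsub>G\<^esub> h = inv\<^bsub>G\<^esub> f"
    using assms(2) by (auto simp: reversible_in_def)
  then have "h \<otimes>\<^bsub>G\<^esub> inv\<^bsub>G\<^esub> f \<otimes>\<^bsub>G\<^esub> inv\<^bsub>G\<^esub> h = inv\<^bsub>G\<^esub> (inv\<^bsub>G\<^esub> f)"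
    by (metis inv_mult_group inv_inv inv_closed m_closed m_assoc)
  then show ?thesis using h by (auto simp: reversible_in_def)
qed

lemma reversible_in_conj:
  assumes "group G" "reversible_in G f" "k \<in> carrier G"
  shows "reversible_in G (k \<otimes>\<^bsub>G\<^esub> f \<otimes>\<^bsub>G\<^esub> inv\<^bsub>G\<^esub> k)"
proof -
  interpret group G by fact
  obtain h where h: "f \<in> carrier G" "h \<in> carrier G" "h \<otimes>\<^bsub>G\<^esub> f \<otimes>\<^bsub>G\<^esub> inv\<^bsub>G\<^esub> h = inv\<^bsub>G\<^esub> f"
    using assms(2) by (auto simp: reversible_in_def)
  let ?h = "k \<otimes>\<^bsub>G\<^esub> h \<otimes>\<^bsub>G\<^esub> inv\<^bsub>G\<^esub> k"
  have cancel: "inv\<^bsub>G\<^esub> k \<otimes>\<^bsub>G\<^esub> (k \<otimes>\<^bsub>G\<^esub> x) = x" if "x \<in> carrier G" for x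
    using that assms(3) by (simp add: m_assoc[symmetric])
  have "?h \<otimes>\<^bsub>G\<^esub> (k \<otimes>\<^bsub>G\<^esub> f \<otimes>\<^bsub>G\<^esub> inv\<^bsub>G\<^esub> k) \<otimes>\<^bsub>G\<^esub> inv\<^bsub>G\<^esub> ?h
      = k \<otimes>\<^bsub>G\<^esub> (h \<otimes>\<^bsub>G\<^esub> f \<otimes>\<^bsub>G\<^esub> inv\<^bsub>G\<^esub> h) \<otimes>\<^bsub>G\<^esub> inv\<^bsub>G\<^esub> k"
    using h(1,2) assms(3) by (simp add: inv_mult_group m_assoc cancel)
  also have "\<dots> = inv\<^bsub>G\<^esub> (k \<otimes>\<^bsub>G\<^esub> f \<otimes>\<^bsub>G\<^esub> inv\<^bsub>G\<^esub> k)"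
    using h assms(3) by (simp add: inv_mult_group m_assoc)
  finally show ?thesis using h(1,2) assms(3) unfolding reversible_in_def by auto
qed

definition product_of_two_reversibles :: "('a, 'b) monoid_scheme \<Rightarrow> 'a \<Rightarrow> bool" where
  "product_of_two_reversibles G f \<longleftrightarrow>
     (\<exists>r s. reversible_in G r \<and> reversible_in G s \<and> f = r \<otimes>\<^bsub>G\<^esub> s)"

lemma product_of_two_reversibles_inv:
  assumes "group G" "product_of_two_reversibles G f"
  shows "product_of_two_reversibles G (inv\<^bsub>G\<^esub> f)"
  using assms reversible_in_inv[OF assms(1)] group.inv_mult_group[OF assms(1)]
  unfolding product_of_two_reversibles_def by (metis reversible_in_def)

lemma product_of_two_reversibles_conj:
  assumes "group G" "product_of_two_reversibles G f" "k \<in> carrier G"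
  shows "product_of_two_reversibles G (k \<otimes>\<^bsub>G\<^esub> f \<otimes>\<^bsub>G\<^esub> inv\<^bsub>G\<^esub> k)"
proof -
  interpret group G by fact
  obtain r s where rs: "reversible_in G r" "reversible_in G s" "f = r \<otimes>\<^bsub>G\<^esub> s"
    using assms(2) by (auto simp: product_of_two_reversibles_def)
  then have c: "r \<in> carrier G" "s \<in> carrier G" by (auto simp: reversible_in_def)
  have cancel: "inv\<^bsub>G\<^esub> k \<otimes>\<^bsub>G\<^esub> (k \<otimes>\<^bsub>G\<^esub> x) = x" if "x \<in> carrier G" for x
    using that assms(3) by (simp add: m_assoc[symmetric])
  have "k \<otimes>\<^bsub>G\<^esub> f \<otimes>\<^bsub>G\<^esub> inv\<^bsub>G\<^esub> k = (k \<otimes>\<^bsub>G\<^esub> r \<otimes>\<^bsub>G\<^esub> inv\<^bsub>G\<^esub> k) \<otimes>\<^bsub>G\<^esub> (k \<otimes>\<^bsub>G\<^esub> s \<otimes>\<^bsub>G\<^esub> inv\<^bsub>G\<^esub> k)"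
    using c assms(3) rs(3) by (simp add: m_assoc cancel)
  then show ?thesis
    using rs reversible_in_conj[OF assms(1) _ assms(3)] by (auto simp: product_of_two_reversibles_def)
qed

section \<open>A reversible lift of a hyperbolic projective map\<close>

text \<open>The lift to the line of the projective action of the matrix \<open>diag(1, 2)\<close> on angles
  (\<open>tan x \<mapsto> 2 tan x\<close>) which fixes the multiples of \<open>pi / 2\<close>.\<close>

definition stretch :: "real \<Rightarrow> real" where
  "stretch x = x + arctan (sin x * cos x / (1 + (sin x)\<^sup>2))"

text \<open>The angle from \<open>(cos x, sin x)\<close> to \<open>(cos x, 2 sin x)\<close> has
  tangent cross product over dot product, that is \<open>sin x cos x\<close> over
  \<open>1 + (sin x)^2\<close>, and \<open>stretch\<close> adds this angle. Positivity of
  \<open>m\<close> records the direction and not just the line.\<close>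

lemma stretch_direction:
  obtains m where "m > 0" "cos (stretch x) = m * cos x" "sin (stretch x) = m * (2 * sin x)"
proof -
  define q where "q = 1 + (sin x)\<^sup>2"
  define d where "d = arctan (sin x * cos x / q)"
  have q: "q > 0" by (simp add: q_def add_pos_nonneg)
  have c: "cos d > 0" using arctan_bounded unfolding d_def by (intro cos_gt_zero_pi) auto
  have "tan d = sin x * cos x / q" by (simp add: d_def tan_arctan)
  then have s: "sin d = cos d * (sin x * cos x) / q"
    using c by (simp add: tan_def field_simps)
  have stretch: "stretch x = x + d" by (simp add: stretch_def d_def q_def)
  show ?thesis
  proof
    show "cos d / q > 0" using c q by simp
    have "cos (stretch x) = cos d / q * (cos x * (q - (sin x)\<^sup>2))"
      unfolding stretch cos_add s using q by (simp add: field_simps power2_eq_square)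
    then show "cos (stretch x) = cos d / q * cos x" by (simp add: q_def)
    have "sin (stretch x) = cos d / q * (sin x * (q + (cos x)\<^sup>2))"
      unfolding stretch sin_add s using q by (simp add: field_simps power2_eq_square)
    also have "q + (cos x)\<^sup>2 = 2" by (simp add: q_def)
    finally show "sin (stretch x) = cos d / q * (2 * sin x)" by simp
  qed
qed

lemma stretch_bounds: "x - pi / 2 < stretch x" "stretch x < x + pi / 2"
  using arctan_bounded unfolding stretch_def by auto

text \<open>The derivative is the determinant 2 over the squared length
  \<open>(cos x)^2 + 4 (sin x)^2\<close> of the image vector. In this form its positivity and
  smoothness are evident.\<close>

lemma stretch_DERIV: "(stretch has_field_derivative 2 / (1 + 3 * (sin x)\<^sup>2)) (at x)"
proof -
  let ?s = "sin x" and ?c = "cos x"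
  have q: "1 + ?s\<^sup>2 > 0" by (simp add: add_pos_nonneg)
  have q3: "1 + 3 * ?s\<^sup>2 > 0" by (simp add: add_pos_nonneg)
  have c: "?c\<^sup>2 = 1 - ?s\<^sup>2" by (simp add: cos_squared_eq)
  let ?d = "((?c * ?c - ?s * ?s) * (1 + ?s\<^sup>2) - ?s * ?c * (2 * ?s * ?c)) / (1 + ?s\<^sup>2)\<^sup>2"
  have D: "(stretch has_field_derivative 1 + ?d / (1 + (?s * ?c / (1 + ?s\<^sup>2))\<^sup>2)) (at x)"
    unfolding stretch_def[abs_def] using q
    by (auto intro!: derivative_eq_intros simp: power2_eq_square divide_simps)
       (simp add: algebra_simps)?
  have "1 + (?s * ?c / (1 + ?s\<^sup>2))\<^sup>2 = (1 + 3 * ?s\<^sup>2) / (1 + ?s\<^sup>2)\<^sup>2"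
    using q by (simp add: power_divide power_mult_distrib c field_simps)
      (simp add: power2_eq_square power4_eq_xxxx algebra_simps)
  moreover have "(?c * ?c - ?s * ?s) * (1 + ?s\<^sup>2) - ?s * ?c * (2 * ?s * ?c) = 1 - 3 * ?s\<^sup>2"
  proof -
    have "(?c * ?c - ?s * ?s) * (1 + ?s\<^sup>2) - ?s * ?c * (2 * ?s * ?c)
        = (?c\<^sup>2 - ?s\<^sup>2) * (1 + ?s\<^sup>2) - 2 * ?s\<^sup>2 * ?c\<^sup>2"
      by (simp add: power2_eq_square)
    then show ?thesis unfolding c by (simp add: algebra_simps)
  qed
  ultimately have "1 + ?d / (1 + (?s * ?c / (1 + ?s\<^sup>2))\<^sup>2) = 1 + (1 - 3 * ?s\<^sup>2) / (1 + 3 * ?s\<^sup>2)"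
    using q by simp
  also have "\<dots> = 2 / (1 + 3 * ?s\<^sup>2)" using q3 by (simp add: field_simps)
  finally show ?thesis using D by simp
qed

lemma stretch_carrier: "stretch \<in> carrier Diffeo_plus"
proof (rule Diffeo_plusI)
  have pos: "1 + 3 * (sin x)\<^sup>2 > 0" for x :: real by (simp add: add_pos_nonneg)
  have "infinitely_differentiable (\<lambda>x. 2 / (1 + 3 * (sin x)\<^sup>2))"
    unfolding power2_eq_square
    using pos by (intro infinitely_differentiable_intros infinitely_differentiable_sin)
      (metis less_irrefl power2_eq_square)
  then show "infinitely_differentiable stretch"
    by (rule infinitely_differentiable_antiderivative[OF stretch_DERIV])
  show "deriv stretch x > 0" for x
    using stretch_DERIV[THEN DERIV_imp_deriv] pos by simp
  show "surj stretch"
  proof (rule surj_real)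
    show "continuous_on UNIV stretch"
      using stretch_DERIV DERIV_isCont by (metis continuous_at_imp_continuous_on)
    show "\<exists>x. stretch x \<le> y" for y
      using stretch_bounds(2)[of "y - pi / 2"] by (intro exI[of _ "y - pi / 2"]) simp
    show "\<exists>x. stretch x \<ge> y" for y
      using stretch_bounds(1)[of "y + pi / 2"] by (intro exI[of _ "y + pi / 2"]) simp
  qed
qed

lemma translation_carrier: "(\<lambda>x. x + c) \<in> carrier Diffeo_plus"
proof (rule Diffeo_plusI)
  have "((\<lambda>x. x + c) has_field_derivative 1) (at x)" for x
    by (auto intro!: derivative_eq_intros)
  then show "deriv (\<lambda>x. x + c) x > 0" for x by (simp add: DERIV_imp_deriv)
  show "surj (\<lambda>x. x + c)" by (metis diff_add_cancel surjI)
qed (intro infinitely_differentiable_intros)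

text \<open>Comparing lengths gives \<open>a = b\<close>, so the angles agree modulo
  \<open>2 * pi\<close>; the distance bound removes the ambiguity. This turns matrix identities into
  identities of lifts.\<close>

lemma eq_of_same_direction:
  assumes "a > 0" "b > 0" "a * cos x = b * cos y" "a * sin x = b * sin y" "\<bar>x - y\<bar> < 2 * pi"
  shows "x = y"
proof -
  have "a\<^sup>2 = (a * cos x)\<^sup>2 + (a * sin x)\<^sup>2"
    by (simp add: power_mult_distrib distrib_left[symmetric])
  also have "\<dots> = b\<^sup>2"
    unfolding assms(3,4) by (simp add: power_mult_distrib distrib_left[symmetric])
  finally have "a = b" using assms(1,2) by (simp add: power2_eq_iff_nonneg)
  then have "sin x = sin y" "cos x = cos y" using assms by auto
  then obtain n :: int where "x = y + 2 * pi * n" using sin_cos_eq_iff by (metis)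
  moreover from this have "\<bar>real_of_int n\<bar> < 1" using assms(5) by (simp add: abs_mult)
  ultimately show ?thesis by simp
qed

text \<open>Rotation by a right angle carries \<open>diag(1, 2)\<close> to its inverse, up to a scalar.\<close>

lemma stretch_stretch: "stretch (stretch x + pi / 2) = x + pi / 2"
proof -
  obtain m where m: "m > 0" "cos (stretch x) = m * cos x" "sin (stretch x) = m * (2 * sin x)"
    using stretch_direction .
  obtain l where l: "l > 0" "cos (stretch (stretch x + pi / 2)) = l * cos (stretch x + pi / 2)"
    "sin (stretch (stretch x + pi / 2)) = l * (2 * sin (stretch x + pi / 2))"
    using stretch_direction .
  \<comment> \<open>For \<open>A = diag(1, 2)\<close> and the quarter turn \<open>R\<close> this is
    \<open>A R A = 2 R\<close>; \<open>l\<close> and \<open>m\<close> are the length factors of the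
    two stretches.\<close>
  have "1 * cos (stretch (stretch x + pi / 2)) = (l * m * 2) * cos (x + pi / 2)"
    "1 * sin (stretch (stretch x + pi / 2)) = (l * m * 2) * sin (x + pi / 2)"
    unfolding l(2,3) by (simp_all add: cos_add sin_add m)
  moreover have "\<bar>stretch (stretch x + pi / 2) - (x + pi / 2)\<bar> < 2 * pi"
    using stretch_bounds[of x] stretch_bounds[of "stretch x + pi / 2"] pi_gt_zero by linarith
  moreover have "l * m * 2 > 0" using l(1) m(1) by simp
  ultimately show ?thesis by (meson eq_of_same_direction zero_less_one)
qed

text \<open>For the translation \<open>?T\<close> by a right angle, the preceding identity says
  \<open>stretch ?T stretch = ?T\<close>, which rearranges to \<open>?T\<close> reversing
  \<open>stretch\<close>.\<close>

lemma stretch_reversible: "reversible_in Diffeo_plus stretch"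
proof -
  interpret group Diffeo_plus by (rule group_Diffeo_plus)
  let ?T = "\<lambda>x. x + pi / 2"
  note c = stretch_carrier translation_carrier[of "pi / 2"]
  have "stretch \<otimes>\<^bsub>Diffeo_plus\<^esub> (?T \<otimes>\<^bsub>Diffeo_plus\<^esub> stretch) = ?T"
    by (simp add: fun_eq_iff stretch_stretch)
  then have "?T \<otimes>\<^bsub>Diffeo_plus\<^esub> stretch \<otimes>\<^bsub>Diffeo_plus\<^esub> inv\<^bsub>Diffeo_plus\<^esub> ?T = inv\<^bsub>Diffeo_plus\<^esub> stretch"
    using c by (metis inv_solve_left inv_solve_right' m_assoc m_closed inv_closed r_inv r_one)
  then show ?thesis using c unfolding reversible_in_def by blast
qed

text \<open>The conjugator is chosen to make the product of \<open>diag(1, 2)\<close> and its conjugate elliptic: the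
  product has trace \<open>31/8\<close> and determinant 4, hence no real eigenvector.\<close>

definition turn :: "real \<Rightarrow> real" where
  "turn x = stretch (x + pi / 4) + pi / 4"

lemma turn_carrier: "turn \<in> carrier Diffeo_plus"
proof -
  have "turn = (\<lambda>x. x + pi / 4) \<circ> stretch \<circ> (\<lambda>x. x + pi / 4)"
    by (simp add: turn_def fun_eq_iff)
  then show ?thesis using stretch_carrier translation_carrier Diffeo_plus_comp by metis
qed

text \<open>Rotating by \<open>pi / 4\<close>, applying \<open>diag(1, 2)\<close> and rotating again
  gives half the matrix with rows \<open>(-1, -3)\<close> and \<open>(3, 1)\<close>.\<close>

lemma turn_direction:
  obtains l where "l > 0" "cos (turn y) = l * (- cos y - 3 * sin y)" "sin (turn y) = l * (3 * cos y + sin y)"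
proof -
  define t :: real where "t = sqrt 2 / 2"
  obtain m where m: "m > 0" "cos (stretch (y + pi / 4)) = m * cos (y + pi / 4)"
    "sin (stretch (y + pi / 4)) = m * (2 * sin (y + pi / 4))"
    using stretch_direction .
  have t: "cos (pi / 4) = t" "sin (pi / 4) = t" "t > 0" by (simp_all add: t_def cos_45 sin_45)
  show ?thesis
  proof
    show "m * t * t > 0" using m t by simp
  qed (unfold turn_def cos_add sin_add m t, simp_all add: algebra_simps)
qed

text \<open>Substituting \<open>x = turn y\<close>, this says that the product of
  \<open>stretch\<close> and its conjugate by \<open>turn\<close> does not fix \<open>x\<close>.
  Equality would make two explicit vectors parallel, but their cross product is a definite quadratic
  form in \<open>cos y\<close> and \<open>sin y\<close>.\<close>

lemma stretch_turn_stretch: "stretch (turn (stretch y)) \<noteq> turn y"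
proof
  assume eq: "stretch (turn (stretch y)) = turn y"
  define c where "c = cos y"
  define s where "s = sin y"
  obtain l where l: "l > 0" "cos (turn y) = l * (- c - 3 * s)" "sin (turn y) = l * (3 * c + s)"
    unfolding c_def s_def using turn_direction .
  obtain m1 where m1: "m1 > 0" "cos (stretch y) = m1 * c" "sin (stretch y) = m1 * (2 * s)"
    unfolding c_def s_def using stretch_direction .
  obtain m2 where m2: "m2 > 0" "cos (turn (stretch y)) = m2 * (- cos (stretch y) - 3 * sin (stretch y))"
    "sin (turn (stretch y)) = m2 * (3 * cos (stretch y) + sin (stretch y))"
    using turn_direction .
  \<comment> \<open>Rewriting with \<open>eq\<close> describes the direction of
    \<open>turn y\<close> a second time, now through both stretches.\<close>
  obtain m3 where m3: "m3 > 0" "cos (turn y) = m3 * cos (turn (stretch y))"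
    "sin (turn y) = m3 * (2 * sin (turn (stretch y)))"
    using stretch_direction[of "turn (stretch y)"] unfolding eq .
  define M where "M = m1 * m2 * m3"
  have M: "M > 0" using m1 m2 m3 by (simp add: M_def)
  have 1: "l * (- c - 3 * s) = M * (- c - 6 * s)" and 2: "l * (3 * c + s) = M * (6 * c + 4 * s)"
    using l m1 m2 m3 by (simp_all add: M_def algebra_simps)
  have "(l * (- c - 3 * s)) * (M * (6 * c + 4 * s)) = (l * (3 * c + s)) * (M * (- c - 6 * s))"
    unfolding 1 2 by (simp add: algebra_simps)
  then have "(l * M) * ((- c - 3 * s) * (6 * c + 4 * s)) = (l * M) * ((3 * c + s) * (- c - 6 * s))"
    by (simp only: mult.assoc mult.commute mult.left_commute)
  then have "(- c - 3 * s) * (6 * c + 4 * s) = (3 * c + s) * (- c - 6 * s)"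
    using l M by simp
  \<comment> \<open>The cross product is \<open>-3 (c^2 + c s + 2 s^2)\<close>, and twice the
    bracket is this sum of squares.\<close>
  then have "(c + s)\<^sup>2 + c\<^sup>2 + 3 * s\<^sup>2 = 0" by (simp add: algebra_simps power2_eq_square)
  moreover have "c\<^sup>2 + s\<^sup>2 = 1" by (simp add: c_def s_def)
  ultimately show False
    using zero_le_power2[of "c + s"] zero_le_power2[of c] zero_le_power2[of s] by linarith
qed

section \<open>Fixed-point-free diffeomorphisms\<close>

lemma no_fixed_point_cases:
  fixes f :: "real \<Rightarrow> real"
  assumes "continuous_on UNIV f" "\<And>x. f x \<noteq> x"
  shows "(\<forall>x. f x > x) \<or> (\<forall>x. f x < x)"
proof (rule ccontr)
  assume "\<not> ?thesis"
  then obtain a b where "f a - a \<le> 0" "f b - b \<ge> 0" by (auto simp: not_less)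
  moreover have "connected (range (\<lambda>x. f x - x))"
    using assms(1) by (intro connected_continuous_image continuous_intros connected_UNIV)
  ultimately have "0 \<in> range (\<lambda>x. f x - x)" by (meson connectedD_interval rangeI)
  then show False using assms(2) by force
qed

lemma Diffeo_plus_inv_apply [simp]:
  assumes "f \<in> carrier Diffeo_plus"
  shows "f ((inv\<^bsub>Diffeo_plus\<^esub> f) x) = x" "(inv\<^bsub>Diffeo_plus\<^esub> f) (f x) = x"
  using Diffeo_plus_inv(2,3)[OF assms] m_inv_Diffeo_plus[OF assms] by (auto simp: fun_eq_iff)

text \<open>The Abel functions \<open>a\<close> and \<open>b\<close> conjugate \<open>f\<close> and
  \<open>w\<close> to the same translation by 1, so \<open>a\<close> inverse followed after
  \<open>b\<close> conjugates \<open>w\<close> to \<open>f\<close>.\<close>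

lemma conj_of_gt:
  assumes f: "f \<in> carrier Diffeo_plus" "\<And>x. f x > x"
    and w: "w \<in> carrier Diffeo_plus" "\<And>x. w x > x"
  obtains k where "k \<in> carrier Diffeo_plus"
    "f = k \<otimes>\<^bsub>Diffeo_plus\<^esub> w \<otimes>\<^bsub>Diffeo_plus\<^esub> inv\<^bsub>Diffeo_plus\<^esub> k"
proof -
  interpret group Diffeo_plus by (rule group_Diffeo_plus)
  obtain a where a: "a \<in> carrier Diffeo_plus" "\<And>x. a (f x) = a x + 1"
    using abel_function[OF f] by blast
  obtain b where b: "b \<in> carrier Diffeo_plus" "\<And>x. b (w x) = b x + 1"
    using abel_function[OF w] by blast
  let ?k = "inv\<^bsub>Diffeo_plus\<^esub> a \<otimes>\<^bsub>Diffeo_plus\<^esub> b"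
  have "f x = (inv\<^bsub>Diffeo_plus\<^esub> a) (b (w ((inv\<^bsub>Diffeo_plus\<^esub> b) (a x))))" for x
    using a b by (metis Diffeo_plus_inv_apply)
  moreover have "inv\<^bsub>Diffeo_plus\<^esub> ?k = inv\<^bsub>Diffeo_plus\<^esub> b \<otimes>\<^bsub>Diffeo_plus\<^esub> a"
    using a b by (simp del: Diffeo_plus_simps add: inv_mult_group)
  ultimately have "f = ?k \<otimes>\<^bsub>Diffeo_plus\<^esub> w \<otimes>\<^bsub>Diffeo_plus\<^esub> inv\<^bsub>Diffeo_plus\<^esub> ?k"
    by (simp add: fun_eq_iff)
  moreover have "?k \<in> carrier Diffeo_plus" using a b by (simp del: Diffeo_plus_simps)
  ultimately show ?thesis using that by blast
qed

lemma inv_gt: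
  assumes "f \<in> carrier Diffeo_plus" "\<And>x. f x < x"
  shows "(inv\<^bsub>Diffeo_plus\<^esub> f) x > x"
  using assms(2)[of "(inv\<^bsub>Diffeo_plus\<^esub> f) x"] Diffeo_plus_inv_apply(1)[OF assms(1)] by simp

text \<open>Only the absence of fixed points of \<open>?w\<close> is known, not the side of the
  identity on which it lies; if it lies below, its inverse is taken.\<close>

lemma product_of_two_reversibles_gt:
  obtains w where "product_of_two_reversibles Diffeo_plus w" "w \<in> carrier Diffeo_plus" "\<And>x. w x > x"
proof -
  interpret group Diffeo_plus by (rule group_Diffeo_plus)
  let ?r = "turn \<otimes>\<^bsub>Diffeo_plus\<^esub> stretch \<otimes>\<^bsub>Diffeo_plus\<^esub> inv\<^bsub>Diffeo_plus\<^esub> turn"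
  let ?w = "stretch \<otimes>\<^bsub>Diffeo_plus\<^esub> ?r"
  note c = stretch_carrier turn_carrier
  have w: "?w \<in> carrier Diffeo_plus" using c by (simp del: Diffeo_plus_simps)
  have prod: "product_of_two_reversibles Diffeo_plus ?w"
    unfolding product_of_two_reversibles_def
    using stretch_reversible reversible_in_conj[OF is_group stretch_reversible turn_carrier] by blast
  have "?w x \<noteq> x" for x
    using stretch_turn_stretch[of "(inv\<^bsub>Diffeo_plus\<^esub> turn) x"] Diffeo_plus_inv_apply[OF turn_carrier]
    by simp
  then consider "\<forall>x. ?w x > x" | "\<forall>x. ?w x < x"
    using no_fixed_point_cases[OF Diffeo_plusD(2)[OF w]] by blast
  then show ?thesis
  proof cases
    case 1
    then show ?thesis using that prod w by blast
  next
    case 2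
    then show ?thesis
      using that[OF product_of_two_reversibles_inv[OF is_group prod]] inv_gt[OF w] w inv_closed by blast
  qed
qed

lemma product_of_two_reversibles_of_gt:
  assumes "f \<in> carrier Diffeo_plus" "\<And>x. f x > x"
  shows "product_of_two_reversibles Diffeo_plus f"
proof -
  obtain w where w: "product_of_two_reversibles Diffeo_plus w" "w \<in> carrier Diffeo_plus" "\<And>x. w x > x"
    using product_of_two_reversibles_gt by blast
  then show ?thesis
    using conj_of_gt[OF assms w(2,3)] product_of_two_reversibles_conj[OF group_Diffeo_plus w(1)] by metis
qed

lemma product_of_two_reversibles_of_lt:
  assumes "f \<in> carrier Diffeo_plus" "\<And>x. f x < x"
  shows "product_of_two_reversibles Diffeo_plus f"
proof -
  interpret group Diffeo_plus by (rule group_Diffeo_plus)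
  have "product_of_two_reversibles Diffeo_plus (inv\<^bsub>Diffeo_plus\<^esub> f)"
    using product_of_two_reversibles_of_gt[OF inv_closed[OF assms(1)] inv_gt[OF assms]] .
  then show ?thesis
    using product_of_two_reversibles_inv[OF is_group] assms(1) by (metis inv_inv)
qed

section \<open>Splitting an arbitrary diffeomorphism\<close>

text \<open>The function \<open>ln (exp x + exp (f x))\<close> is a smooth strict upper bound of
  \<open>x\<close> and \<open>f x\<close>. Its derivative is a weighted mean of 1 and
  \<open>deriv f x\<close>, hence positive.\<close>

lemma dominating_diffeo:
  assumes f: "f \<in> carrier Diffeo_plus"
  obtains g where "g \<in> carrier Diffeo_plus" "\<And>x. g x > x" "\<And>x. g x > f x"
proof -
  define g where "g x = ln (exp x + exp (f x))" for x
  have pos: "exp x + exp (f x) > 0" for x by (simp add: add_pos_pos)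
  have gt: "g x > x" "g x > f x" for x
    unfolding g_def by (subst ln_exp[symmetric], subst ln_less_cancel_iff; simp add: pos)+
  note sf = Diffeo_plusD(1)[OF f]
  define g' where "g' = (\<lambda>x. (exp x + exp (f x) * deriv f x) / (exp x + exp (f x)))"
  have D: "(g has_field_derivative g' x) (at x)" for x
    unfolding g_def[abs_def] g'_def using pos[of x]
    by (auto intro!: derivative_eq_intros infinitely_differentiable_DERIV[OF sf])
  have "infinitely_differentiable g'"
    unfolding g'_def using pos[THEN less_imp_neq[THEN not_sym]]
    by (intro infinitely_differentiable_intros infinitely_differentiable_exp
        infinitely_differentiable_deriv[OF sf]
        infinitely_differentiable_compose[OF infinitely_differentiable_exp sf])
  then have sm: "infinitely_differentiable g"
    using infinitely_differentiable_antiderivative[OF D] by blast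
  have "surj g"
  proof (rule surj_real)
    show "continuous_on UNIV g"
      using D DERIV_isCont by (metis continuous_at_imp_continuous_on)
    show "\<exists>x. y \<le> g x" for y using gt(1)[of y] by (intro exI[of _ y]) simp
    show "\<exists>x. g x \<le> y" for y
    proof -
      \<comment> \<open>At \<open>z\<close> both exponents are at most \<open>y - ln 2\<close>, so
        the two exponentials add up to at most \<open>exp y\<close>.\<close>
      define z where "z = min (y - ln 2) ((inv\<^bsub>Diffeo_plus\<^esub> f) (y - ln 2))"
      have "f z \<le> f ((inv\<^bsub>Diffeo_plus\<^esub> f) (y - ln 2))"
        using Diffeo_plusD(3)[OF f] by (simp add: z_def strict_mono_less_eq)
      then have "f z \<le> y - ln 2" "z \<le> y - ln 2" using f by (simp_all del: Diffeo_plus_simps add: z_def)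
      then have "exp z + exp (f z) \<le> 2 * exp (y - ln 2)"
        using exp_le_cancel_iff[of z "y - ln 2"] exp_le_cancel_iff[of "f z" "y - ln 2"] by linarith
      then have "exp z + exp (f z) \<le> exp y" by (simp add: exp_diff)
      then have "g z \<le> y" unfolding g_def using pos by (metis ln_exp ln_le_cancel_iff exp_gt_zero)
      then show ?thesis by blast
    qed
  qed
  moreover have "deriv g x > 0" for x
    using D[THEN DERIV_imp_deriv] Diffeo_plusD(5)[OF f] pos by (simp add: g'_def add_pos_pos)
  ultimately show ?thesis using that gt Diffeo_plusI sm by blast
qed

theorem theorem1p3:
  fixes f :: "real \<Rightarrow> real"
  assumes "f \<in> carrier Diffeo_plus"
  shows "\<exists>f1 f2 f3 f4.
           reversible_in Diffeo_plus f1 \<and> reversible_in Diffeo_plus f2 \<and>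
           reversible_in Diffeo_plus f3 \<and> reversible_in Diffeo_plus f4 \<and>
           f = f1 \<otimes>\<^bsub>Diffeo_plus\<^esub> f2 \<otimes>\<^bsub>Diffeo_plus\<^esub> f3 \<otimes>\<^bsub>Diffeo_plus\<^esub> f4"
proof -
  interpret group Diffeo_plus by (rule group_Diffeo_plus)
  obtain g where g: "g \<in> carrier Diffeo_plus" "\<And>x. g x > x" "\<And>x. g x > f x"
    using dominating_diffeo[OF assms] by blast
  \<comment> \<open>As \<open>g\<close> lies above \<open>f\<close>, \<open>p\<close> sends each
    \<open>g y\<close> to the smaller value \<open>f y\<close>, so it lies below the
    identity.\<close>
  define p where "p = f \<otimes>\<^bsub>Diffeo_plus\<^esub> inv\<^bsub>Diffeo_plus\<^esub> g"
  have "p x < x" for x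
    using g(3)[of "(inv\<^bsub>Diffeo_plus\<^esub> g) x"] Diffeo_plus_inv_apply(1)[OF g(1)] by (simp add: p_def)
  moreover have "p \<in> carrier Diffeo_plus" unfolding p_def using assms g(1) m_closed inv_closed by blast
  ultimately have "product_of_two_reversibles Diffeo_plus p"
    using product_of_two_reversibles_of_lt by blast
  then obtain f1 f2 where 12: "reversible_in Diffeo_plus f1" "reversible_in Diffeo_plus f2"
      "p = f1 \<otimes>\<^bsub>Diffeo_plus\<^esub> f2"
    unfolding product_of_two_reversibles_def by blast
  obtain f3 f4 where 34: "reversible_in Diffeo_plus f3" "reversible_in Diffeo_plus f4"
      "g = f3 \<otimes>\<^bsub>Diffeo_plus\<^esub> f4"
    using product_of_two_reversibles_of_gt[OF g(1,2)] unfolding product_of_two_reversibles_def by blast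
  have "f = p \<otimes>\<^bsub>Diffeo_plus\<^esub> g"
    unfolding p_def using assms g(1) by (metis inv_closed l_inv m_assoc r_one)
  also have "\<dots> = f1 \<otimes>\<^bsub>Diffeo_plus\<^esub> f2 \<otimes>\<^bsub>Diffeo_plus\<^esub> f3 \<otimes>\<^bsub>Diffeo_plus\<^esub> f4"
    by (simp add: 12(3) 34(3) o_assoc)
  finally show ?thesis using 12 34 by blast
qed

end
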